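(* Let $(X_1,d_1)$ and $(X_2,d_2)$ be roughly geodesic, Gromov hyperbolic metric spaces and let $z_i\in X_i$ for $i=1,2$. For $\Delta\ge 0$ let $$Y_\Delta:=\{(x_1,x_2)\in X_1\times X_2 \;:\; |d_1(x_1,z_1)-d_2(x_2,z_2)|\le \Delta\}$$ be equipped with the restriction of the metric $d_m\big((x_1,x_2),(x_1',x_2')\big):=\max\{d_1(x_1,x_1'),d_2(x_2,x_2')\}$. Then there exists $\tilde\Delta\ge 0$ such that for all $\Delta\ge\tilde\Delta$ the space $(Y_\Delta,d_m|_{Y_\Delta\times Y_\Delta})$ is roughly geodesic (and Gromov hyperbolic). Moreover, its boundary at infinity is naturally homeomorphic to $\partial_\infty(X_1,d_1)\times\partial_\infty(X_2,d_2)$ (with the product topology), the natural map being $[\{(x_1^i,x_2^i)\}_i]\mapsto([\{x_1^i\}_i],[\{x_2^i\}_i])$.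
   Context: Gromov hyperbolicity: a metric space $(X,d)$ is $\delta$-hyperbolic ($\delta\ge 0$) if for all $x,y,z,w\in X$: $d(x,y)+d(z,w)\le \max\{d(x,z)+d(y,w),d(x,w)+d(y,z)\}+2\delta$; it is Gromov hyperbolic if it is $\delta$-hyperbolic for some $\delta\ge 0$. Rough geodesics: for $k\ge 0$, a $k$-rough-isometric embedding $f:(A,d_A)\to(X,d)$ is a (not necessarily continuous) map with $d_A(a,a')-k\le d(f(a),f(a'))\le d_A(a,a')+k$ for all $a,a'\in A$. A $k$-rough geodesic connecting $x$ to $x'$ in $X$ is a $k$-rough-isometric embedding $\gamma:[\alpha,\omega]\to X$ of a compact real interval with $\gamma(\alpha)=x$, $\gamma(\omega)=x'$. $(X,d)$ is $k$-roughly geodesic if any two points are connected by a $k$-rough geodesic, and roughly geodesic if it is $k$-roughly geodesic for some $k\ge 0$. Boundary at infinity: let $(X,d)$ be Gromov hyperbolic, $z\in X$ a basepoint, and $(x\cdot y)_z:=\frac12[d(x,z)+d(y,z)-d(x,y)]$. A sequence $\{x^i\}$ in $X$ converges to infinity if $\liminf_{i,j\to\infty}(x^i\cdot x^j)_z=\infty$. Two sequences $\{x^i\},\{y^i\}$ converging to infinity are equivalent if $\liminf_{i,j\to\infty}(x^i\cdot y^j)_z=\infty$. This is an equivalence relation; $\partial_\infty X=\partial_\infty(X,d)$ is the set of equivalence classes $[\{x^i\}]$. It carries the topology generated by the sets $$U(v,r):=\{w\in\partial_\infty X : \exists \{x^k\},\{y^k\}\text{ with }[\{x^k\}]=v,\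 [\{y^k\}]=w,\ \liminf_{k,l\to\infty}(x^k\cdot y^l)_z>r\},\quad v\in\partial_\infty X,\ r>0.$$
   Formalization: The boundary topology takes the sets U(v,r) as basic neighbourhoods of v (a set is open iff around each of its points v it contains some U(v,r)), not as a subbase of open sets; with the subbase reading of "generated by" the homeomorphism claim is false. *)

theory Defs
  imports "HOL-Analysis.Analysis"
begin

text \<open>
  A metric space is given by a carrier \<open>X\<close> and a distance \<open>d\<close> as in the library locale
  \<^locale>\<open>Metric_space\<close>; the predicates below are meant to be used under that assumption.
\<close>

definition delta_hyperbolic :: "real \<Rightarrow> 'a set \<Rightarrow> ('a \<Rightarrow> 'a \<Rightarrow> real) \<Rightarrow> bool" where
  "delta_hyperbolic \<delta> X d \<longleftrightarrow>
     (\<forall>x\<in>X. \<forall>y\<in>X. \<forall>z\<in>X. \<forall>w\<in>X.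
        d x y + d z w \<le> max (d x z + d y w) (d x w + d y z) + 2 * \<delta>)"

definition gromov_hyperbolic :: "'a set \<Rightarrow> ('a \<Rightarrow> 'a \<Rightarrow> real) \<Rightarrow> bool" where
  "gromov_hyperbolic X d \<longleftrightarrow> (\<exists>\<delta>\<ge>0. delta_hyperbolic \<delta> X d)"

definition rough_isometric_embedding ::
    "real \<Rightarrow> 'b set \<Rightarrow> ('b \<Rightarrow> 'b \<Rightarrow> real) \<Rightarrow> 'a set \<Rightarrow> ('a \<Rightarrow> 'a \<Rightarrow> real) \<Rightarrow> ('b \<Rightarrow> 'a) \<Rightarrow> bool" where
  "rough_isometric_embedding k A dA X d f \<longleftrightarrow>
     f ` A \<subseteq> X \<and>
     (\<forall>a\<in>A. \<forall>a'\<in>A. dA a a' - k \<le> d (f a) (f a') \<and> d (f a) (f a') \<le> dA a a' + k)"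

definition rough_geodesic ::
    "real \<Rightarrow> 'a set \<Rightarrow> ('a \<Rightarrow> 'a \<Rightarrow> real) \<Rightarrow> real \<Rightarrow> real \<Rightarrow> (real \<Rightarrow> 'a) \<Rightarrow> 'a \<Rightarrow> 'a \<Rightarrow> bool" where
  "rough_geodesic k X d \<alpha> \<omega> \<gamma> x x' \<longleftrightarrow>
     \<alpha> \<le> \<omega> \<and> rough_isometric_embedding k {\<alpha>..\<omega>} dist X d \<gamma> \<and> \<gamma> \<alpha> = x \<and> \<gamma> \<omega> = x'"

definition roughly_geodesic :: "'a set \<Rightarrow> ('a \<Rightarrow> 'a \<Rightarrow> real) \<Rightarrow> bool" where
  "roughly_geodesic X d \<longleftrightarrow>
     (\<exists>k\<ge>0. \<forall>x\<in>X. \<forall>x'\<in>X. \<exists>\<alpha> \<omega> \<gamma>. rough_geodesic k X d \<alpha> \<omega> \<gamma> x x')"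

definition gromov_product :: "('a \<Rightarrow> 'a \<Rightarrow> real) \<Rightarrow> 'a \<Rightarrow> 'a \<Rightarrow> 'a \<Rightarrow> real" where
  "gromov_product d z x y = (d x z + d y z - d x y) / 2"

text \<open>The joint lower limit as both indices tend to infinity independently, in the extended reals.\<close>

definition liminf_product ::
    "('a \<Rightarrow> 'a \<Rightarrow> real) \<Rightarrow> 'a \<Rightarrow> (nat \<Rightarrow> 'a) \<Rightarrow> (nat \<Rightarrow> 'a) \<Rightarrow> ereal" where
  "liminf_product d z x y =
     Liminf (sequentially \<times>\<^sub>F sequentially) (\<lambda>(i, j). ereal (gromov_product d z (x i) (y j)))"

definition seqs_to_infinity :: "'a set \<Rightarrow> ('a \<Rightarrow> 'a \<Rightarrow> real) \<Rightarrow> 'a \<Rightarrow> (nat \<Rightarrow> 'a) set" where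
  "seqs_to_infinity X d z = {x. range x \<subseteq> X \<and> liminf_product d z x x = \<infinity>}"

definition boundary_rel ::
    "'a set \<Rightarrow> ('a \<Rightarrow> 'a \<Rightarrow> real) \<Rightarrow> 'a \<Rightarrow> ((nat \<Rightarrow> 'a) \<times> (nat \<Rightarrow> 'a)) set" where
  "boundary_rel X d z =
     {(x, y). x \<in> seqs_to_infinity X d z \<and> y \<in> seqs_to_infinity X d z \<and> liminf_product d z x y = \<infinity>}"

definition boundary_class ::
    "'a set \<Rightarrow> ('a \<Rightarrow> 'a \<Rightarrow> real) \<Rightarrow> 'a \<Rightarrow> (nat \<Rightarrow> 'a) \<Rightarrow> (nat \<Rightarrow> 'a) set" where
  "boundary_class X d z x = boundary_rel X d z `` {x}"

definition boundary_at_infinity ::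
    "'a set \<Rightarrow> ('a \<Rightarrow> 'a \<Rightarrow> real) \<Rightarrow> 'a \<Rightarrow> (nat \<Rightarrow> 'a) set set" where
  "boundary_at_infinity X d z = seqs_to_infinity X d z // boundary_rel X d z"

definition boundary_nbhd ::
    "'a set \<Rightarrow> ('a \<Rightarrow> 'a \<Rightarrow> real) \<Rightarrow> 'a \<Rightarrow> (nat \<Rightarrow> 'a) set \<Rightarrow> real \<Rightarrow> (nat \<Rightarrow> 'a) set set" where
  "boundary_nbhd X d z v r =
     {w \<in> boundary_at_infinity X d z.
        \<exists>x\<in>seqs_to_infinity X d z. \<exists>y\<in>seqs_to_infinity X d z.
          boundary_class X d z x = v \<and> boundary_class X d z y = w \<and>
          liminf_product d z x y > ereal r}"

text \<open>
  The topology generated by the sets \<open>boundary_nbhd X d z v r\<close> as basic neighbourhoods of \<open>v\<close>: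
  a set is open iff with each of its points \<open>v\<close> it contains \<open>boundary_nbhd X d z v r\<close> for some
  \<open>r > 0\<close>. They are not taken as a subbase of open sets: the Gromov product is only determined up
  to a bounded error at infinity, so \<open>boundary_nbhd X d z v r\<close> is a neighbourhood of \<open>v\<close> but need
  not be open in the usual topology of the boundary. The subbase topology can be strictly finer,
  depends on the basepoint and is not preserved by rough isometries.
\<close>

definition boundary_topology ::
    "'a set \<Rightarrow> ('a \<Rightarrow> 'a \<Rightarrow> real) \<Rightarrow> 'a \<Rightarrow> (nat \<Rightarrow> 'a) set topology" where
  "boundary_topology X d z =
     topology (\<lambda>S. S \<subseteq> boundary_at_infinity X d z \<and>
                   (\<forall>v\<in>S. \<exists>r>0. boundary_nbhd X d z v r \<subseteq> S))"

lemma boundary_nbhd_mono: "r \<le> s \<Longrightarrow> boundary_nbhd X d z v s \<subseteq> boundary_nbhd X d z v r"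
proof
  fix w
  assume "r \<le> s" and "w \<in> boundary_nbhd X d z v s"
  then obtain x y where w: "w \<in> boundary_at_infinity X d z"
    and xy: "x \<in> seqs_to_infinity X d z" "y \<in> seqs_to_infinity X d z"
      "boundary_class X d z x = v" "boundary_class X d z y = w"
    and gt: "ereal s < liminf_product d z x y"
    unfolding boundary_nbhd_def by auto
  have "ereal r < liminf_product d z x y"
    using \<open>r \<le> s\<close> gt by (meson ereal_less_eq(3) le_less_trans)
  then show "w \<in> boundary_nbhd X d z v r"
    unfolding boundary_nbhd_def using w xy by auto
qed

lemma openin_boundary_topology:
  "openin (boundary_topology X d z) S \<longleftrightarrow>
     S \<subseteq> boundary_at_infinity X d z \<and> (\<forall>v\<in>S. \<exists>r>0. boundary_nbhd X d z v r \<subseteq> S)"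
proof -
  have "istopology (\<lambda>S. S \<subseteq> boundary_at_infinity X d z \<and>
          (\<forall>v\<in>S. \<exists>r>0. boundary_nbhd X d z v r \<subseteq> S))"
    unfolding istopology_def
  proof (intro conjI allI impI)
    fix S T
    assume S: "S \<subseteq> boundary_at_infinity X d z \<and> (\<forall>v\<in>S. \<exists>r>0. boundary_nbhd X d z v r \<subseteq> S)"
      and T: "T \<subseteq> boundary_at_infinity X d z \<and> (\<forall>v\<in>T. \<exists>r>0. boundary_nbhd X d z v r \<subseteq> T)"
    show "S \<inter> T \<subseteq> boundary_at_infinity X d z" using S by blast
    show "\<forall>v\<in>S \<inter> T. \<exists>r>0. boundary_nbhd X d z v r \<subseteq> S \<inter> T"
    proof
      fix v assume "v \<in> S \<inter> T"
      then obtain r s where "r > 0" "boundary_nbhd X d z v r \<subseteq> S"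
          "s > 0" "boundary_nbhd X d z v s \<subseteq> T"
        using S T by blast
      then show "\<exists>r>0. boundary_nbhd X d z v r \<subseteq> S \<inter> T"
        using boundary_nbhd_mono[of r "max r s" X d z v] boundary_nbhd_mono[of s "max r s" X d z v]
        by (intro exI[of _ "max r s"]) auto
    qed
  next
    fix \<K>
    assume K: "\<forall>S\<in>\<K>. S \<subseteq> boundary_at_infinity X d z \<and>
      (\<forall>v\<in>S. \<exists>r>0. boundary_nbhd X d z v r \<subseteq> S)"
    show "\<Union>\<K> \<subseteq> boundary_at_infinity X d z" using K by (simp add: Sup_le_iff)
    show "\<forall>v\<in>\<Union>\<K>. \<exists>r>0. boundary_nbhd X d z v r \<subseteq> \<Union>\<K>"
    proof
      fix v assume "v \<in> \<Union>\<K>"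
      then obtain S where "S \<in> \<K>" "v \<in> S" by auto
      then obtain r where "r > 0" "boundary_nbhd X d z v r \<subseteq> S" using K by meson
      then show "\<exists>r>0. boundary_nbhd X d z v r \<subseteq> \<Union>\<K>"
        using \<open>S \<in> \<K>\<close> by (intro exI[of _ r]) auto
    qed
  qed
  then show ?thesis
    unfolding boundary_topology_def by simp
qed

lemma topspace_boundary_topology [simp]:
  "topspace (boundary_topology X d z) = boundary_at_infinity X d z"
proof
  show "topspace (boundary_topology X d z) \<subseteq> boundary_at_infinity X d z"
    by (rule openin_boundary_topology[THEN iffD1, OF openin_topspace, THEN conjunct1])
  have "boundary_nbhd X d z v 1 \<subseteq> boundary_at_infinity X d z" for v
    unfolding boundary_nbhd_def by (rule Collect_restrict)
  then have "openin (boundary_topology X d z) (boundary_at_infinity X d z)"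
    unfolding openin_boundary_topology by (meson order_refl zero_less_one)
  then show "boundary_at_infinity X d z \<subseteq> topspace (boundary_topology X d z)"
    by (rule openin_subset)
qed

definition max_dist ::
    "('a \<Rightarrow> 'a \<Rightarrow> real) \<Rightarrow> ('b \<Rightarrow> 'b \<Rightarrow> real) \<Rightarrow> 'a \<times> 'b \<Rightarrow> 'a \<times> 'b \<Rightarrow> real" where
  "max_dist d1 d2 = (\<lambda>(x1, x2) (x1', x2'). max (d1 x1 x1') (d2 x2 x2'))"

definition diagonal_product ::
    "'a set \<Rightarrow> ('a \<Rightarrow> 'a \<Rightarrow> real) \<Rightarrow> 'a \<Rightarrow> 'b set \<Rightarrow> ('b \<Rightarrow> 'b \<Rightarrow> real) \<Rightarrow> 'b \<Rightarrow> real \<Rightarrow> ('a \<times> 'b) set" where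
  "diagonal_product X1 d1 z1 X2 d2 z2 \<Delta> =
     {(x1, x2). x1 \<in> X1 \<and> x2 \<in> X2 \<and> \<bar>d1 x1 z1 - d2 x2 z2\<bar> \<le> \<Delta>}"

end

theory Submission
  imports Defs
begin

text \<open>
  Based at \<open>(z1, z2)\<close>, the Gromov product of \<open>Y\<close> agrees up to \<open>\<Delta>\<close> with the minimum of the Gromov
  products of the two components. Hence \<open>Y\<close> is hyperbolic, and convergence to infinity, equivalence
  and neighbourhoods at infinity in \<open>Y\<close> are, up to a bounded change of radius, those of the two
  components separately. For rough geodesics, take points \<open>\<rho>\<^sub>x(s)\<close> at height \<open>s\<close> on rough geodesics from
  the basepoint of a factor to \<open>x\<close>; up to a bounded error,
  \<open>d (\<rho>\<^sub>x(s)) (\<rho>\<^sub>y(t)) = s + t - 2 * min s t (x\<cdot>y)\<close>. Moving in both factors simultaneously down from \<open>x\<close> to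
  the height of the smaller of the two Gromov products and then up to \<open>y\<close> is a rough geodesic for the
  maximum metric, because the factor with the smaller product realises the full length. Equal heights
  in the two factors keep the path in \<open>Y\<close> once \<open>\<Delta>\<close> exceeds the roughness constants.
\<close>

section \<open>Gromov products\<close>

definition eventual_product_ge ::
    "('a \<Rightarrow> 'a \<Rightarrow> real) \<Rightarrow> 'a \<Rightarrow> (nat \<Rightarrow> 'a) \<Rightarrow> (nat \<Rightarrow> 'a) \<Rightarrow> real \<Rightarrow> bool" where
  "eventual_product_ge d z x y r \<longleftrightarrow> (\<exists>N. \<forall>i\<ge>N. \<forall>j\<ge>N. r \<le> gromov_product d z (x i) (y j))"

lemma eventual_product_ge_mono:
  assumes "eventual_product_ge d z x y r" "r' \<le> r + c"
    and "\<And>i j. gromov_product d z (x i) (y j) + c \<le> gromov_product d' z' (x' i) (y' j)"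
  shows "eventual_product_ge d' z' x' y' r'"
proof -
  obtain N where N: "\<And>i j. i \<ge> N \<Longrightarrow> j \<ge> N \<Longrightarrow> r \<le> gromov_product d z (x i) (y j)"
    using assms(1) unfolding eventual_product_ge_def by auto
  have "r' \<le> gromov_product d' z' (x' i) (y' j)" if "i \<ge> N" "j \<ge> N" for i j
    using N[OF that] assms(2) assms(3)[of i j] by linarith
  then show ?thesis unfolding eventual_product_ge_def by blast
qed

lemma eventual_product_ge_conj:
  assumes "eventual_product_ge d z x y r" "eventual_product_ge d' z' x' y' r'"
    and "\<And>i j. min (gromov_product d z (x i) (y j)) (gromov_product d' z' (x' i) (y' j)) 
           \<le> gromov_product d'' z'' (x'' i) (y'' j)"
  shows "eventual_product_ge d'' z'' x'' y'' (min r r')"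
proof -
  obtain N where N: "\<And>i j. i \<ge> N \<Longrightarrow> j \<ge> N \<Longrightarrow> r \<le> gromov_product d z (x i) (y j)"
    using assms(1) unfolding eventual_product_ge_def by auto
  obtain N' where N': "\<And>i j. i \<ge> N' \<Longrightarrow> j \<ge> N' \<Longrightarrow> r' \<le> gromov_product d' z' (x' i) (y' j)"
    using assms(2) unfolding eventual_product_ge_def by auto
  have "min r r' \<le> gromov_product d'' z'' (x'' i) (y'' j)" if "i \<ge> max N N'" "j \<ge> max N N'" for i j
    using N[of i j] N'[of i j] that assms(3)[of i j] by auto
  then show ?thesis unfolding eventual_product_ge_def by blast
qed

lemma eventual_product_ge_if_less_liminf:
  assumes "ereal r < liminf_product d z x y"
  shows "eventual_product_ge d z x y r"
proof -
  have "\<forall>\<^sub>F (i, j) in sequentially \<times>\<^sub>F sequentially. ereal r < ereal (gromov_product d z (x i) (y j))"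
    using less_LiminfD[OF assms[unfolded liminf_product_def]] by (simp add: case_prod_unfold)
  then show ?thesis
    unfolding eventually_prod_sequentially eventual_product_ge_def
    by simp (meson less_imp_le)
qed

lemma liminf_product_ge:
  assumes "eventual_product_ge d z x y r"
  shows "ereal r \<le> liminf_product d z x y"
  unfolding liminf_product_def
proof (rule Liminf_bounded)
  show "\<forall>\<^sub>F p in sequentially \<times>\<^sub>F sequentially.
          ereal r \<le> (case p of (i, j) \<Rightarrow> ereal (gromov_product d z (x i) (y j)))"
    using assms unfolding eventually_prod_sequentially eventual_product_ge_def by auto
qed

lemma liminf_product_eq_infinity_iff:
  "liminf_product d z x y = \<infinity> \<longleftrightarrow> (\<forall>r. eventual_product_ge d z x y r)"
proof
  assume "liminf_product d z x y = \<infinity>"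
  then show "\<forall>r. eventual_product_ge d z x y r"
    by (simp add: eventual_product_ge_if_less_liminf)
next
  assume "\<forall>r. eventual_product_ge d z x y r"
  then have "ereal r \<le> liminf_product d z x y" for r
    by (simp add: liminf_product_ge)
  then show "liminf_product d z x y = \<infinity>"
    by (meson ereal_top)
qed

lemma mem_seqs_to_infinity:
  "x \<in> seqs_to_infinity X d z \<longleftrightarrow> range x \<subseteq> X \<and> (\<forall>r. eventual_product_ge d z x x r)"
  by (simp add: seqs_to_infinity_def liminf_product_eq_infinity_iff)

lemma mem_boundary_rel:
  "(x, y) \<in> boundary_rel X d z \<longleftrightarrow>
     x \<in> seqs_to_infinity X d z \<and> y \<in> seqs_to_infinity X d z \<and> (\<forall>r. eventual_product_ge d z x y r)"
  by (simp add: boundary_rel_def liminf_product_eq_infinity_iff)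

lemma mem_boundary_nbhd:
  "w \<in> boundary_nbhd X d z v r \<longleftrightarrow>
     w \<in> boundary_at_infinity X d z \<and>
     (\<exists>x\<in>seqs_to_infinity X d z. \<exists>y\<in>seqs_to_infinity X d z. \<exists>s>r.
        boundary_class X d z x = v \<and> boundary_class X d z y = w \<and> eventual_product_ge d z x y s)"
    (is "?L \<longleftrightarrow> ?R")
proof
  assume ?L
  then obtain x y where *: "w \<in> boundary_at_infinity X d z" "x\<in>seqs_to_infinity X d z"
      "y\<in>seqs_to_infinity X d z" "boundary_class X d z x = v" "boundary_class X d z y = w"
      "ereal r < liminf_product d z x y"
    unfolding boundary_nbhd_def by auto
  obtain e where "ereal r < e" "e < liminf_product d z x y"
    using dense[OF *(6)] by blast
  then obtain s where "ereal r < ereal s" "ereal s < liminf_product d z x y"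
    by (cases e) auto
  with * show ?R
    using eventual_product_ge_if_less_liminf by (metis ereal_less(1) less_ereal.simps(1))
next
  assume ?R
  then obtain x y s where *: "w \<in> boundary_at_infinity X d z" "x\<in>seqs_to_infinity X d z"
      "y\<in>seqs_to_infinity X d z" "boundary_class X d z x = v" "boundary_class X d z y = w"
      "s > r" "eventual_product_ge d z x y s"
    by auto
  have "ereal r < liminf_product d z x y"
    using liminf_product_ge[OF *(7)] \<open>s > r\<close> by (meson ereal_less_le less_ereal.simps(1) less_le_trans)
  with * show ?L unfolding boundary_nbhd_def by blast
qed

context Metric_space
begin

lemma gromov_product_commute: "gromov_product d z x y = gromov_product d z y x"
  by (simp add: gromov_product_def commute)

lemma gromov_product_nonneg:
  "\<lbrakk>x \<in> M; y \<in> M; z \<in> M\<rbrakk> \<Longrightarrow> 0 \<le> gromov_product d z x y"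
  using triangle[of x z y] by (simp add: gromov_product_def commute)

lemma gromov_product_le:
  "\<lbrakk>x \<in> M; y \<in> M; z \<in> M\<rbrakk> \<Longrightarrow> gromov_product d z x y \<le> d x z"
  using triangle[of y x z] by (simp add: gromov_product_def commute)

lemma gromov_product_change_base:
  assumes "x \<in> M" "y \<in> M" "z \<in> M" "p \<in> M"
  shows "gromov_product d z x y \<le> gromov_product d p x y + d z p"
  using triangle[of x p z] triangle[of y p z] assms commute[of p z]
  by (simp add: gromov_product_def field_simps)

lemma eventual_product_ge_change_base:
  assumes "eventual_product_ge d z x y r" "range x \<subseteq> M" "range y \<subseteq> M" "z \<in> M" "p \<in> M"
  shows "eventual_product_ge d p x y (r - d z p)"
proof (rule eventual_product_ge_mono[OF assms(1), of _ "- d z p"])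
  fix i j
  show "gromov_product d z (x i) (y j) + - d z p \<le> gromov_product d p (x i) (y j)"
    using gromov_product_change_base[of "x i" "y j" z p] assms by (simp add: range_subsetD)
qed simp

lemma eventual_product_ge_all_change_base:
  assumes "range x \<subseteq> M" "range y \<subseteq> M" "z \<in> M" "p \<in> M"
  shows "(\<forall>r. eventual_product_ge d z x y r) \<longleftrightarrow> (\<forall>r. eventual_product_ge d p x y r)"
proof -
  have "\<forall>r. eventual_product_ge d v x y r" 
    if "\<forall>r. eventual_product_ge d u x y r" "u \<in> M" "v \<in> M" for u v
  proof
    fix r
    show "eventual_product_ge d v x y r"
      using eventual_product_ge_change_base[of u x y "r + d u v" v] that assms by simp
  qed
  then show ?thesis using assms by blast
qed

lemma seqs_to_infinity_change_base:
  assumes "z \<in> M" "p \<in> M"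
  shows "seqs_to_infinity M d z = seqs_to_infinity M d p"
  using eventual_product_ge_all_change_base[OF _ _ assms]
  by (auto simp: mem_seqs_to_infinity)

lemma boundary_rel_change_base:
  assumes "z \<in> M" "p \<in> M"
  shows "boundary_rel M d z = boundary_rel M d p"
proof -
  have "(x, y) \<in> boundary_rel M d z \<longleftrightarrow> (x, y) \<in> boundary_rel M d p" for x y
    using eventual_product_ge_all_change_base[OF _ _ assms, of x y]
    unfolding mem_boundary_rel seqs_to_infinity_change_base[OF assms]
    by (meson mem_seqs_to_infinity)
  then show ?thesis by auto
qed

lemma boundary_class_change_base:
  "\<lbrakk>z \<in> M; p \<in> M\<rbrakk> \<Longrightarrow> boundary_class M d z = boundary_class M d p"
  by (simp add: boundary_class_def fun_eq_iff boundary_rel_change_base[of z p])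

lemma boundary_at_infinity_change_base:
  "\<lbrakk>z \<in> M; p \<in> M\<rbrakk> \<Longrightarrow> boundary_at_infinity M d z = boundary_at_infinity M d p"
  by (simp add: boundary_at_infinity_def boundary_rel_change_base[of z p]
      seqs_to_infinity_change_base[of z p])

lemma boundary_nbhd_change_base:
  assumes "z \<in> M" "p \<in> M"
  shows "boundary_nbhd M d z v (r + d z p) \<subseteq> boundary_nbhd M d p v r"
proof
  fix w assume "w \<in> boundary_nbhd M d z v (r + d z p)"
  then obtain x y s where *: "w \<in> boundary_at_infinity M d z" "x\<in>seqs_to_infinity M d z"
      "y\<in>seqs_to_infinity M d z" "boundary_class M d z x = v" "boundary_class M d z y = w"
      "s > r + d z p" "eventual_product_ge d z x y s"
    unfolding mem_boundary_nbhd by blast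
  have "eventual_product_ge d p x y (s - d z p)"
    using eventual_product_ge_change_base[of z x y s p] * assms
    by (simp add: mem_seqs_to_infinity)
  moreover have "s - d z p > r" using * by simp
  ultimately show "w \<in> boundary_nbhd M d p v r"
    using * unfolding mem_boundary_nbhd boundary_at_infinity_change_base[OF assms]
      seqs_to_infinity_change_base[OF assms] boundary_class_change_base[OF assms] by blast
qed

lemma boundary_topology_change_base:
  assumes "z \<in> M" "p \<in> M"
  shows "boundary_topology M d z = boundary_topology M d p"
proof -
  have "openin (boundary_topology M d v) S" 
    if S: "openin (boundary_topology M d u) S" and "u \<in> M" "v \<in> M" for u v S
    unfolding openin_boundary_topology
  proof (intro conjI ballI)
    show "S \<subseteq> boundary_at_infinity M d v"
      using S that boundary_at_infinity_change_base[of u v] by (simp add: openin_boundary_topology)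
    fix w assume "w \<in> S"
    then obtain r where r: "r > 0" "boundary_nbhd M d u w r \<subseteq> S"
      using S unfolding openin_boundary_topology by blast
    have "0 < r + d v u" using r(1) nonneg[of v u] by linarith
    moreover have "boundary_nbhd M d v w (r + d v u) \<subseteq> S"
      using boundary_nbhd_change_base[of v u w r] that r(2) by blast
    ultimately show "\<exists>r>0. boundary_nbhd M d v w r \<subseteq> S" by blast
  qed
  then show ?thesis using assms by (auto simp: topology_eq)
qed

end

lemma delta_hyperbolic_if_gromov_product_ge_min:
  assumes "Metric_space X d" "z \<in> X"
    and ge: "\<And>x y w. \<lbrakk>x \<in> X; y \<in> X; w \<in> X\<rbrakk> \<Longrightarrow>
      min (gromov_product d z x w) (gromov_product d z w y) - \<delta> \<le> gromov_product d z x y"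
  shows "delta_hyperbolic (2 * \<delta>) X d"
  unfolding delta_hyperbolic_def
proof (intro ballI)
  interpret Metric_space X d by fact
  fix x y u w assume X: "x \<in> X" "y \<in> X" "u \<in> X" "w \<in> X"
  define g where "g = gromov_product d z"
  have sym: "g a b = g b a" for a b by (simp add: g_def gromov_product_commute)
  have ge: "min (g a c) (g c b) - \<delta> \<le> g a b" if "a \<in> X" "b \<in> X" "c \<in> X" for a b c
    unfolding g_def by (rule ge[OF that])
  \<comment> \<open>the two products adjacent to the largest of the four mixed products bound the left side\<close>
  have "min (g x u + g y w) (g x w + g y u) - 2 * \<delta> \<le> g x y + g u w"
    using ge[OF X(1,2,3)] ge[OF X(1,2,4)] ge[OF X(3,4,1)] ge[OF X(3,4,2)]
      sym[of u x] sym[of u y] sym[of w x] sym[of w y] by linarith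
  then show "d x y + d u w \<le> max (d x u + d y w) (d x w + d y u) + 2 * (2 * \<delta>)"
    unfolding g_def gromov_product_def by (simp add: min_def max_def field_simps split: if_splits)
qed

section \<open>The boundary of a pointed hyperbolic space\<close>

locale pointed_hyperbolic = Metric_space +
  fixes \<delta> :: real and z :: 'a
  assumes delta_nonneg: "0 \<le> \<delta>"
    and hyperbolic: "delta_hyperbolic \<delta> M d"
    and base_in: "z \<in> M"
begin

abbreviation gp :: "'a \<Rightarrow> 'a \<Rightarrow> real" where
  "gp \<equiv> gromov_product d z"

lemma gp_ge_min:
  assumes "x \<in> M" "y \<in> M" "w \<in> M"
  shows "min (gp x w) (gp w y) - \<delta> \<le> gp x y"
proof -
  have "d x y + d w z \<le> max (d x w + d y z) (d x z + d y w) + 2 * \<delta>"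
    using hyperbolic assms base_in unfolding delta_hyperbolic_def by blast
  then show ?thesis
    unfolding gromov_product_def by (simp add: commute min_def max_def field_simps split: if_splits)
qed

lemma gp_ge_min3:
  assumes "x \<in> M" "y \<in> M" "x' \<in> M" "y' \<in> M"
  shows "min (gp x x') (min (gp x' y') (gp y' y)) - 2 * \<delta> \<le> gp x y"
  using gp_ge_min[of x y x'] gp_ge_min[of x' y y'] assms delta_nonneg by linarith

lemma eventual_product_ge_min:
  assumes "eventual_product_ge d z x y r" "eventual_product_ge d z y w s"
    and "range x \<subseteq> M" "range y \<subseteq> M" "range w \<subseteq> M"
  shows "eventual_product_ge d z x w (min r s - \<delta>)"
proof -
  obtain N where N: "\<And>i j. i \<ge> N \<Longrightarrow> j \<ge> N \<Longrightarrow> r \<le> gp (x i) (y j)"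
    using assms(1) unfolding eventual_product_ge_def by auto
  obtain N' where N': "\<And>i j. i \<ge> N' \<Longrightarrow> j \<ge> N' \<Longrightarrow> s \<le> gp (y i) (w j)"
    using assms(2) unfolding eventual_product_ge_def by auto
  have "min r s - \<delta> \<le> gp (x i) (w j)" if "i \<ge> max N N'" "j \<ge> max N N'" for i j
    using N[of i "max N N'"] N'[of "max N N'" j] that
      gp_ge_min[of "x i" "w j" "y (max N N')"] assms(3-5) by fastforce
  then show ?thesis unfolding eventual_product_ge_def by blast
qed

lemma eventual_product_ge_commute:
  "eventual_product_ge d z x y r \<longleftrightarrow> eventual_product_ge d z y x r"
  unfolding eventual_product_ge_def by (metis gromov_product_commute)

lemma boundary_rel_if_product_unbounded:
  assumes x: "x \<in> seqs_to_infinity M d z" and y: "range y \<subseteq> M"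
    and unbounded: "\<And>r. \<exists>N. \<forall>i\<ge>N. r \<le> gp (x i) (y i)"
  shows "(x, y) \<in> boundary_rel M d z"
proof -
  have xM: "range x \<subseteq> M" using x by (simp add: mem_seqs_to_infinity)
  have xy: "eventual_product_ge d z x y r" for r
  proof -
    obtain N where N: "\<And>i j. i \<ge> N \<Longrightarrow> j \<ge> N \<Longrightarrow> r + \<delta> \<le> gp (x i) (x j)"
      using x unfolding mem_seqs_to_infinity eventual_product_ge_def by meson
    obtain N' where N': "\<And>i. i \<ge> N' \<Longrightarrow> r + \<delta> \<le> gp (x i) (y i)"
      using unbounded[of "r + \<delta>"] by auto
    have "r \<le> gp (x i) (y j)" if "i \<ge> max N N'" "j \<ge> max N N'" for i j
    proof -
      have "min (gp (x i) (x j)) (gp (x j) (y j)) - \<delta> \<le> gp (x i) (y j)"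
        using xM y by (intro gp_ge_min) auto
      then show ?thesis using N[of i j] N'[of j] that by auto
    qed
    then show ?thesis unfolding eventual_product_ge_def by blast
  qed
  have "eventual_product_ge d z y y r" for r
    using eventual_product_ge_min[of y x "r + \<delta>" y "r + \<delta>"] xy eventual_product_ge_commute xM y
    by auto
  then show ?thesis using x y xy by (simp add: mem_boundary_rel mem_seqs_to_infinity)
qed

lemma equiv_boundary_rel: "equiv (seqs_to_infinity M d z) (boundary_rel M d z)"
proof (rule equivI)
  show "boundary_rel M d z \<subseteq> seqs_to_infinity M d z \<times> seqs_to_infinity M d z"
    by (auto simp: mem_boundary_rel)
  show "refl_on (seqs_to_infinity M d z) (boundary_rel M d z)"
    by (auto simp: refl_on_def mem_boundary_rel mem_seqs_to_infinity)
  show "sym (boundary_rel M d z)"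
    by (auto simp: sym_def mem_boundary_rel eventual_product_ge_commute)
  have "eventual_product_ge d z x w r"
    if "(x, y) \<in> boundary_rel M d z" "(y, w) \<in> boundary_rel M d z" for x y w r
    using eventual_product_ge_min[of x y "r + \<delta>" w "r + \<delta>"] that
    by (auto simp: mem_boundary_rel mem_seqs_to_infinity)
  then show "trans (boundary_rel M d z)"
    unfolding trans_def by (meson mem_boundary_rel)
qed

lemma boundary_class_eq_iff:
  assumes "x \<in> seqs_to_infinity M d z" "y \<in> seqs_to_infinity M d z"
  shows "boundary_class M d z x = boundary_class M d z y \<longleftrightarrow> (x, y) \<in> boundary_rel M d z"
  using eq_equiv_class_iff[OF equiv_boundary_rel assms] by (simp add: boundary_class_def)

lemma boundary_class_in_boundary:
  "x \<in> seqs_to_infinity M d z \<Longrightarrow> boundary_class M d z x \<in> boundary_at_infinity M d z"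
  by (simp add: boundary_class_def boundary_at_infinity_def quotientI)

lemma boundary_at_infinity_eq:
  "boundary_at_infinity M d z = boundary_class M d z ` seqs_to_infinity M d z"
  by (auto simp: boundary_class_def boundary_at_infinity_def quotient_def)

lemma mem_boundary_nbhd_if_eventual_product_ge:
  assumes "x \<in> seqs_to_infinity M d z" "y \<in> seqs_to_infinity M d z"
    "eventual_product_ge d z x y s" "r < s"
  shows "boundary_class M d z y \<in> boundary_nbhd M d z (boundary_class M d z x) r"
  using assms boundary_class_in_boundary[of y] unfolding mem_boundary_nbhd by blast

lemma eventual_product_ge_if_mem_boundary_nbhd:
  assumes x: "x \<in> seqs_to_infinity M d z" and y: "y \<in> seqs_to_infinity M d z"
    and "boundary_class M d z y \<in> boundary_nbhd M d z (boundary_class M d z x) r"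
  shows "eventual_product_ge d z x y (r - 2 * \<delta>)"
proof -
  obtain x' y' s where *: "x' \<in> seqs_to_infinity M d z" "y' \<in> seqs_to_infinity M d z"
      "boundary_class M d z x' = boundary_class M d z x"
      "boundary_class M d z y' = boundary_class M d z y"
      "s > r" "eventual_product_ge d z x' y' s"
    using assms(3) unfolding mem_boundary_nbhd by blast
  have rel: "(x', x) \<in> boundary_rel M d z" "(y', y) \<in> boundary_rel M d z"
    using * x y boundary_class_eq_iff by blast+
  have M: "range x \<subseteq> M" "range y \<subseteq> M" "range x' \<subseteq> M" "range y' \<subseteq> M"
    using x y * by (auto simp: mem_seqs_to_infinity)
  have "eventual_product_ge d z x x' s" 
    using rel(1) eventual_product_ge_commute by (auto simp: mem_boundary_rel)
  then have 1: "eventual_product_ge d z x y' (s - \<delta>)"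
    using eventual_product_ge_min[of x x' s y' s] * M by simp
  have "eventual_product_ge d z y' y (s - \<delta>)" 
    using rel(2) by (auto simp: mem_boundary_rel)
  then have "eventual_product_ge d z x y (s - \<delta> - \<delta>)"
    using eventual_product_ge_min[of x y' "s - \<delta>" y "s - \<delta>"] 1 M by simp
  then show ?thesis
    by (rule eventual_product_ge_mono[where c = 0]) (use \<open>s > r\<close> in auto)
qed

lemma boundary_nbhd_trans:
  assumes "u \<in> boundary_nbhd M d z v s" "w \<in> boundary_nbhd M d z u s" 
    and s: "r + 3 * \<delta> < s"
  shows "w \<in> boundary_nbhd M d z v r"
proof -
  obtain x where x: "x \<in> seqs_to_infinity M d z" "v = boundary_class M d z x"
    using assms(1) unfolding mem_boundary_nbhd by blast
  obtain y where y: "y \<in> seqs_to_infinity M d z" "u = boundary_class M d z y"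
    using assms(1) unfolding mem_boundary_nbhd by blast
  obtain t where t: "t \<in> seqs_to_infinity M d z" "w = boundary_class M d z t"
    using assms(2) unfolding mem_boundary_nbhd by blast
  have "eventual_product_ge d z x t (min (s - 2 * \<delta>) (s - 2 * \<delta>) - \<delta>)"
    using eventual_product_ge_if_mem_boundary_nbhd assms x y t
    by (intro eventual_product_ge_min[of x y]) (auto simp: mem_seqs_to_infinity)
  then show ?thesis
    using mem_boundary_nbhd_if_eventual_product_ge[OF x(1) t(1)] s x(2) t(2) by simp
qed

lemma self_in_boundary_nbhd:
  "v \<in> boundary_at_infinity M d z \<Longrightarrow> v \<in> boundary_nbhd M d z v r"
  using mem_boundary_nbhd_if_eventual_product_ge[of _ _ "r + 1" r]
  by (auto simp: boundary_at_infinity_eq mem_seqs_to_infinity)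

lemma boundary_nbhd_contains_open:
  assumes "v \<in> boundary_at_infinity M d z"
  obtains U where "openin (boundary_topology M d z) U" "v \<in> U" "U \<subseteq> boundary_nbhd M d z v r"
proof
  define U where "U = {w \<in> boundary_at_infinity M d z. \<exists>s>0. boundary_nbhd M d z w s \<subseteq> boundary_nbhd M d z v r}"
  show "openin (boundary_topology M d z) U"
    unfolding openin_boundary_topology
  proof (intro conjI ballI)
    show "U \<subseteq> boundary_at_infinity M d z" by (auto simp: U_def)
    fix w assume "w \<in> U"
    then obtain s where s: "s > 0" "boundary_nbhd M d z w s \<subseteq> boundary_nbhd M d z v r"
      by (auto simp: U_def)
    define t where "t = s + 3 * \<delta> + 1"
    have t: "t > 0" "s + 3 * \<delta> < t" using s delta_nonneg by (auto simp: t_def)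
    have "u \<in> U" if u: "u \<in> boundary_nbhd M d z w t" for u
    proof -
      have "boundary_nbhd M d z u t \<subseteq> boundary_nbhd M d z v r"
        using boundary_nbhd_trans[OF u _ t(2)] s(2) by blast
      then show ?thesis using t u unfolding U_def mem_boundary_nbhd by auto
    qed
    then show "\<exists>r>0. boundary_nbhd M d z w r \<subseteq> U" using t by blast
  qed
  show "v \<in> U"
    using assms boundary_nbhd_mono[of r "max r 1" M d z v] unfolding U_def
    by (auto intro!: exI[of _ "max r 1"])
  show "U \<subseteq> boundary_nbhd M d z v r"
    unfolding U_def using self_in_boundary_nbhd by blast
qed

section \<open>Radial paths\<close>

definition radial_path :: "real \<Rightarrow> 'a \<Rightarrow> (real \<Rightarrow> 'a) \<Rightarrow> bool" where
  "radial_path K x \<rho> \<longleftrightarrow> 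
     (\<forall>s\<in>{0..d x z}. \<rho> s \<in> M \<and> \<bar>d (\<rho> s) z - s\<bar> \<le> K \<and> \<bar>d (\<rho> s) x - (d x z - s)\<bar> \<le> K \<and>
        (\<forall>s'\<in>{0..d x z}. \<bar>d (\<rho> s) (\<rho> s') - \<bar>s - s'\<bar>\<bar> \<le> K))"

lemma radial_path_gp:
  assumes "radial_path K x \<rho>" "x \<in> M" "0 \<le> s" "s \<le> d x z"
  shows "s - K \<le> gp (\<rho> s) x"
proof -
  have "\<bar>d (\<rho> s) z - s\<bar> \<le> K" "\<bar>d (\<rho> s) x - (d x z - s)\<bar> \<le> K"
    using assms unfolding radial_path_def by auto
  then show ?thesis unfolding gromov_product_def by argo
qed

lemma radial_path_mono:
  assumes "radial_path K x \<rho>" "K \<le> K'"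
  shows "radial_path K' x \<rho>"
  using assms unfolding radial_path_def by (meson order_trans)

lemma radial_path_exists:
  assumes "roughly_geodesic M d"
  shows "\<exists>K\<ge>0. \<forall>x\<in>M. \<exists>\<rho>. radial_path K x \<rho>"
proof -
  obtain k where k: "k \<ge> 0" "\<And>x x'. \<lbrakk>x \<in> M; x' \<in> M\<rbrakk> \<Longrightarrow> \<exists>\<alpha> \<omega> \<gamma>. rough_geodesic k M d \<alpha> \<omega> \<gamma> x x'"
    using assms unfolding roughly_geodesic_def by blast
  have "\<exists>\<rho>. radial_path (2 * k) x \<rho>" if "x \<in> M" for x
  proof -
    obtain \<alpha> \<omega> \<gamma> where "rough_geodesic k M d \<alpha> \<omega> \<gamma> z x"
      using k(2)[OF base_in \<open>x \<in> M\<close>] by blast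
    then have le: "\<alpha> \<le> \<omega>" and ends: "\<gamma> \<alpha> = z" "\<gamma> \<omega> = x"
      and M: "\<And>a. a \<in> {\<alpha>..\<omega>} \<Longrightarrow> \<gamma> a \<in> M"
      and emb: "\<forall>a\<in>{\<alpha>..\<omega>}. \<forall>b\<in>{\<alpha>..\<omega>}. \<bar>a - b\<bar> - k \<le> d (\<gamma> a) (\<gamma> b) \<and> d (\<gamma> a) (\<gamma> b) \<le> \<bar>a - b\<bar> + k"
      unfolding rough_geodesic_def rough_isometric_embedding_def by (auto simp: dist_real_def)
    have emb: "\<bar>d (\<gamma> a) (\<gamma> b) - \<bar>a - b\<bar>\<bar> \<le> k" if "a \<in> {\<alpha>..\<omega>}" "b \<in> {\<alpha>..\<omega>}" for a b
      using emb[rule_format, OF that] by linarith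
    define \<tau> where "\<tau> s = min (\<alpha> + s) \<omega>" for s
    have \<tau>: "\<tau> s \<in> {\<alpha>..\<omega>}" if "s \<ge> 0" for s using that le by (auto simp: \<tau>_def)
    have len: "\<bar>d x z - (\<omega> - \<alpha>)\<bar> \<le> k"
      using emb[of \<omega> \<alpha>] le ends by simp
    have \<tau>_le: "\<tau> s \<le> \<alpha> + s" "\<alpha> + s - k \<le> \<tau> s" if "s \<in> {0..d x z}" for s
      using that len k(1) by (auto simp: \<tau>_def)
    have "radial_path (2 * k) x (\<lambda>s. \<gamma> (\<tau> s))"
      unfolding radial_path_def
    proof (intro ballI conjI)
      fix s assume s: "s \<in> {0..d x z}"
      show "\<gamma> (\<tau> s) \<in> M" using M \<tau> s by auto
      show "\<bar>d (\<gamma> (\<tau> s)) z - s\<bar> \<le> 2 * k"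
        using emb[OF \<tau>, of s \<alpha>] ends le s len unfolding \<tau>_def by auto
      show "\<bar>d (\<gamma> (\<tau> s)) x - (d x z - s)\<bar> \<le> 2 * k"
        using emb[OF \<tau>, of s \<omega>] ends le s len unfolding \<tau>_def by auto
      fix s' assume s': "s' \<in> {0..d x z}"
      show "\<bar>d (\<gamma> (\<tau> s)) (\<gamma> (\<tau> s')) - \<bar>s - s'\<bar>\<bar> \<le> 2 * k"
        using emb[OF \<tau> \<tau>, of s s'] \<tau>_le[OF s] \<tau>_le[OF s'] s s' by auto
    qed
    then show ?thesis by blast
  qed
  then show ?thesis using k(1) by (intro exI[of _ "2 * k"]) auto
qed

lemma radial_path_tripod:
  assumes \<rho>: "radial_path K x \<rho>" and \<eta>: "radial_path K y \<eta>" and M: "x \<in> M" "y \<in> M"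
    and s: "0 \<le> s" "s \<le> d x z" and t: "0 \<le> t" "t \<le> d y z"
  shows "\<bar>d (\<rho> s) (\<eta> t) - (s + t - 2 * min (min s t) (gp x y))\<bar> \<le> 6 * K + 4 * \<delta>"
proof -
  have in_M: "\<rho> s \<in> M" "\<eta> t \<in> M" and heights: "\<bar>d (\<rho> s) z - s\<bar> \<le> K" "\<bar>d (\<eta> t) z - t\<bar> \<le> K"
    using \<rho> \<eta> s t unfolding radial_path_def by auto
  note commutes = gromov_product_commute[of z x "\<rho> s"] gromov_product_commute[of z y "\<eta> t"]
    gromov_product_commute[of z "\<eta> t" "\<rho> s"]
  have ge: "s - K \<le> gp (\<rho> s) x" "t - K \<le> gp (\<eta> t) y"
    using radial_path_gp \<rho> \<eta> M s t by auto
  have le: "gp (\<rho> s) (\<eta> t) \<le> d (\<rho> s) z" "gp (\<rho> s) (\<eta> t) \<le> d (\<eta> t) z"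
    using gromov_product_le[OF in_M base_in] gromov_product_le[OF in_M(2,1) base_in] commutes by auto
  have "min (gp (\<rho> s) x) (min (gp x y) (gp y (\<eta> t))) - 2 * \<delta> \<le> gp (\<rho> s) (\<eta> t)"
    using in_M M by (intro gp_ge_min3)
  then have lower: "min (min s t) (gp x y) - K - 2 * \<delta> \<le> gp (\<rho> s) (\<eta> t)"
    using ge commutes heights by linarith
  have "min (gp x (\<rho> s)) (min (gp (\<rho> s) (\<eta> t)) (gp (\<eta> t) y)) - 2 * \<delta> \<le> gp x y"
    using in_M M by (intro gp_ge_min3)
  then have upper: "gp (\<rho> s) (\<eta> t) \<le> min (min s t) (gp x y) + 2 * K + 2 * \<delta>"
    using ge commutes heights le delta_nonneg by linarith
  have "d (\<rho> s) (\<eta> t) = d (\<rho> s) z + d (\<eta> t) z - 2 * gp (\<rho> s) (\<eta> t)"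
    by (simp add: gromov_product_def field_simps)
  then show ?thesis using lower upper heights by linarith
qed

end

lemma (in Metric_space) rough_geodesic_extend_ends:
  assumes "0 \<le> L" and f: "\<And>a. a \<in> {0..L} \<Longrightarrow> f a \<in> M"
    and emb: "\<And>a b. \<lbrakk>a \<in> {0..L}; b \<in> {0..L}\<rbrakk> \<Longrightarrow> \<bar>d (f a) (f b) - \<bar>a - b\<bar>\<bar> \<le> k"
    and x: "x \<in> M" "d x (f 0) \<le> c" and y: "y \<in> M" "d y (f L) \<le> c"
  shows "\<exists>\<alpha> \<omega> \<gamma>. rough_geodesic (k + 2 * c + 2) M d \<alpha> \<omega> \<gamma> x y"
proof -
  define g where "g t = (if t < 0 then x else if t > L then y else f t)" for t
  define \<tau> where "\<tau> t = max 0 (min t L)" for t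
  have c: "c \<ge> 0" using x(2) nonneg[of x "f 0"] by linarith
  have \<tau>: "\<tau> t \<in> {0..L}" for t using \<open>0 \<le> L\<close> by (auto simp: \<tau>_def)
  have g: "g t \<in> M" for t using f x y by (auto simp: g_def)
  have close: "d (g t) (f (\<tau> t)) \<le> c" for t
    using x y f[OF \<tau>, of t] c \<open>0 \<le> L\<close> by (auto simp: g_def \<tau>_def)
  have "\<bar>a - b\<bar> - (k + 2 * c + 2) \<le> d (g a) (g b) \<and> d (g a) (g b) \<le> \<bar>a - b\<bar> + (k + 2 * c + 2)"
    if "a \<in> {-1..L+1}" "b \<in> {-1..L+1}" for a b
  proof -
    have "\<bar>a - \<tau> a\<bar> \<le> 1" "\<bar>b - \<tau> b\<bar> \<le> 1" using that \<open>0 \<le> L\<close> by (auto simp: \<tau>_def)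
    moreover have "d (g a) (g b) \<le> d (g a) (f (\<tau> a)) + d (f (\<tau> a)) (f (\<tau> b)) + d (g b) (f (\<tau> b))"
      using triangle[of "g a" "f (\<tau> a)" "g b"] triangle[of "f (\<tau> a)" "f (\<tau> b)" "g b"] g f[OF \<tau>]
        commute[of "f (\<tau> b)" "g b"] by simp
    moreover have "d (f (\<tau> a)) (f (\<tau> b)) \<le> d (g a) (f (\<tau> a)) + d (g a) (g b) + d (g b) (f (\<tau> b))"
      using triangle[of "f (\<tau> a)" "g a" "f (\<tau> b)"] triangle[of "g a" "g b" "f (\<tau> b)"] g f[OF \<tau>]
        commute[of "f (\<tau> a)" "g a"] by simp
    ultimately show ?thesis using close[of a] close[of b] emb[OF \<tau> \<tau>, of a b] by linarith
  qed
  then have "rough_geodesic (k + 2 * c + 2) M d (-1) (L + 1) g x y"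
    unfolding rough_geodesic_def rough_isometric_embedding_def
    using g \<open>0 \<le> L\<close> by (auto simp: dist_real_def) (auto simp: g_def)
  then show ?thesis by blast
qed

section \<open>The diagonal product\<close>

lemma max_dist_eq: "max_dist d1 d2 x y = max (d1 (fst x) (fst y)) (d2 (snd x) (snd y))"
  by (simp add: max_dist_def case_prod_unfold)

lemma abs_max_diff_le:
  fixes a b :: real
  assumes "\<bar>a - a'\<bar> \<le> c" "\<bar>b - b'\<bar> \<le> c"
  shows "\<bar>max a b - max a' b'\<bar> \<le> c"
  using assms by linarith

lemma Metric_space_max_dist:
  assumes "Metric_space M1 d1" "Metric_space M2 d2" "Y \<subseteq> M1 \<times> M2"
  shows "Metric_space Y (max_dist d1 d2)"
proof
  interpret H1: Metric_space M1 d1 by fact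
  interpret H2: Metric_space M2 d2 by fact
  fix x y
  show "0 \<le> max_dist d1 d2 x y" by (simp add: max_dist_eq le_max_iff_disj)
  show "max_dist d1 d2 x y = max_dist d1 d2 y x"
    by (simp add: max_dist_eq H1.commute H2.commute)
  assume xy: "x \<in> Y" "y \<in> Y"
  then have M: "fst x \<in> M1" "fst y \<in> M1" "snd x \<in> M2" "snd y \<in> M2" using assms(3) by auto
  show "max_dist d1 d2 x y = 0 \<longleftrightarrow> x = y"
  proof
    assume "max_dist d1 d2 x y = 0"
    then have "d1 (fst x) (fst y) = 0" "d2 (snd x) (snd y) = 0"
      using H1.nonneg[of "fst x" "fst y"] H2.nonneg[of "snd x" "snd y"] unfolding max_dist_eq by linarith+
    then show "x = y" using M by (simp add: prod_eq_iff)
  qed (use M in \<open>simp add: max_dist_eq\<close>)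
  fix w assume "w \<in> Y"
  then have "fst w \<in> M1" "snd w \<in> M2" using assms(3) by auto
  then show "max_dist d1 d2 x w \<le> max_dist d1 d2 x y + max_dist d1 d2 y w"
    using H1.triangle[of "fst x" "fst y" "fst w"] H2.triangle[of "snd x" "snd y" "snd w"] M
    unfolding max_dist_eq by linarith
qed

locale hyperbolic_pair =
  H1: pointed_hyperbolic M1 d1 \<delta>1 z1 + H2: pointed_hyperbolic M2 d2 \<delta>2 z2
  for M1 :: "'a set" and d1 \<delta>1 z1 and M2 :: "'b set" and d2 \<delta>2 z2 +
  fixes \<Delta> :: real
  assumes Delta_nonneg: "0 \<le> \<Delta>"
begin

abbreviation Y :: "('a \<times> 'b) set" where
  "Y \<equiv> diagonal_product M1 d1 z1 M2 d2 z2 \<Delta>"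

abbreviation dm :: "'a \<times> 'b \<Rightarrow> 'a \<times> 'b \<Rightarrow> real" where
  "dm \<equiv> max_dist d1 d2"

abbreviation q :: "'a \<times> 'b" where
  "q \<equiv> (z1, z2)"

lemma mem_Y: "x \<in> Y \<longleftrightarrow> fst x \<in> M1 \<and> snd x \<in> M2 \<and> \<bar>d1 (fst x) z1 - d2 (snd x) z2\<bar> \<le> \<Delta>"
  by (simp add: diagonal_product_def case_prod_unfold)

lemma q_in_Y: "q \<in> Y"
  using H1.base_in H2.base_in Delta_nonneg by (simp add: mem_Y)

sublocale Y: Metric_space Y dm
  by (rule Metric_space_max_dist[OF H1.Metric_space_axioms H2.Metric_space_axioms])
    (auto simp: mem_Y)

lemma gp_Y_ge: "min (H1.gp (fst x) (fst y)) (H2.gp (snd x) (snd y)) \<le> gromov_product dm q x y"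
  by (simp add: gromov_product_def max_dist_eq min_def max_def)

lemma gp_Y_le:
  assumes "x \<in> Y" "y \<in> Y"
  shows "gromov_product dm q x y \<le> H1.gp (fst x) (fst y) + \<Delta>"
    and "gromov_product dm q x y \<le> H2.gp (snd x) (snd y) + \<Delta>"
  using assms by (auto simp: gromov_product_def max_dist_eq mem_Y abs_le_iff field_simps)

lemma gp_Y_ge_min:
  assumes "x \<in> Y" "y \<in> Y" "w \<in> Y"
  shows "min (gromov_product dm q x w) (gromov_product dm q w y) - (\<Delta> + \<delta>1 + \<delta>2)
           \<le> gromov_product dm q x y"
  using gp_Y_ge[of x y] gp_Y_le[OF assms(1,3)] gp_Y_le[OF assms(3,2)]
    H1.gp_ge_min[of "fst x" "fst y" "fst w"] H2.gp_ge_min[of "snd x" "snd y" "snd w"] assms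
    H1.delta_nonneg H2.delta_nonneg
  by (simp add: mem_Y)

sublocale Y: pointed_hyperbolic Y dm "2 * (\<Delta> + \<delta>1 + \<delta>2)" q
proof
  show "0 \<le> 2 * (\<Delta> + \<delta>1 + \<delta>2)" using Delta_nonneg H1.delta_nonneg H2.delta_nonneg by simp
  show "delta_hyperbolic (2 * (\<Delta> + \<delta>1 + \<delta>2)) Y dm"
    using delta_hyperbolic_if_gromov_product_ge_min[OF Y.Metric_space_axioms q_in_Y] gp_Y_ge_min
    by blast
qed (rule q_in_Y)

lemma roughly_geodesic_Y:
  assumes K: "0 \<le> K" "2 * K \<le> \<Delta>"
    and ex1: "\<And>x. x \<in> M1 \<Longrightarrow> \<exists>\<rho>. H1.radial_path K x \<rho>"
    and ex2: "\<And>x. x \<in> M2 \<Longrightarrow> \<exists>\<rho>. H2.radial_path K x \<rho>"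
  shows "roughly_geodesic Y dm"
proof -
  obtain \<rho>1 where \<rho>1: "\<And>x. x \<in> M1 \<Longrightarrow> H1.radial_path K x (\<rho>1 x)" using ex1 by metis
  obtain \<rho>2 where \<rho>2: "\<And>x. x \<in> M2 \<Longrightarrow> H2.radial_path K x (\<rho>2 x)" using ex2 by metis
  \<comment> \<open>Where the heights of the components of \<open>x\<close> differ by \<open>\<Delta>\<close>, the roughness of the radial paths could
    push the path out of \<open>Y\<close>; it therefore jumps from \<open>x\<close> straight to a pair at the common height \<open>m x\<close>.\<close>
  define m where "m x = min (d1 (fst x) z1) (d2 (snd x) z2)" for x
  define r where "r x s = (\<rho>1 (fst x) s, \<rho>2 (snd x) s)" for x s
  define p where "p x y = min (H1.gp (fst x) (fst y)) (H2.gp (snd x) (snd y))" for x y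
  define C where "C = 6 * K + 4 * \<delta>1 + 4 * \<delta>2"
  have C: "K \<le> C" "6 * K + 4 * \<delta>1 \<le> C" "6 * K + 4 * \<delta>2 \<le> C"
    using K H1.delta_nonneg H2.delta_nonneg by (auto simp: C_def)
  note rad1 = \<rho>1[unfolded H1.radial_path_def, rule_format]
    and rad2 = \<rho>2[unfolded H2.radial_path_def, rule_format]
  have rY: "r x s \<in> Y" if "x \<in> Y" "s \<in> {0..m x}" for x s
    using rad1[of "fst x" s] rad2[of "snd x" s] that K by (auto simp: mem_Y r_def m_def)
  have same: "\<bar>dm (r x s) (r x t) - \<bar>s - t\<bar>\<bar> \<le> C" if "x \<in> Y" "s \<in> {0..m x}" "t \<in> {0..m x}" for x s t
  proof -
    have "\<bar>d1 (\<rho>1 (fst x) s) (\<rho>1 (fst x) t) - \<bar>s - t\<bar>\<bar> \<le> K"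
         "\<bar>d2 (\<rho>2 (snd x) s) (\<rho>2 (snd x) t) - \<bar>s - t\<bar>\<bar> \<le> K"
      using rad1[of "fst x" s] rad2[of "snd x" s] that by (auto simp: mem_Y m_def)
    then show ?thesis using C(1) by (simp add: max_dist_eq r_def max_def)
  qed
  have tripod: "\<bar>dm (r x s) (r y t) - (s + t - 2 * min (min s t) (p x y))\<bar> \<le> C"
    if "x \<in> Y" "y \<in> Y" "s \<in> {0..m x}" "t \<in> {0..m y}" for x y s t
  proof -
    have "\<bar>d1 (\<rho>1 (fst x) s) (\<rho>1 (fst y) t) - (s + t - 2 * min (min s t) (H1.gp (fst x) (fst y)))\<bar> \<le> C"
      using H1.radial_path_tripod[OF \<rho>1 \<rho>1, of "fst x" "fst y" s t] that C(2)
      by (auto simp: mem_Y m_def)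
    moreover have "\<bar>d2 (\<rho>2 (snd x) s) (\<rho>2 (snd y) t) - (s + t - 2 * min (min s t) (H2.gp (snd x) (snd y)))\<bar> \<le> C"
      using H2.radial_path_tripod[OF \<rho>2 \<rho>2, of "snd x" "snd y" s t] that C(3)
      by (auto simp: mem_Y m_def)
    moreover have "s + t - 2 * min (min s t) (p x y) =
        max (s + t - 2 * min (min s t) (H1.gp (fst x) (fst y))) (s + t - 2 * min (min s t) (H2.gp (snd x) (snd y)))"
      unfolding p_def by (simp add: min_def max_def)
    ultimately show ?thesis
      unfolding max_dist_eq r_def fst_conv snd_conv by (simp only: abs_max_diff_le)
  qed
  have top: "dm x (r x (m x)) \<le> \<Delta> + K" if "x \<in> Y" for x
  proof -
    have "\<bar>d1 (\<rho>1 (fst x) (m x)) (fst x) - (d1 (fst x) z1 - m x)\<bar> \<le> K"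
         "\<bar>d2 (\<rho>2 (snd x) (m x)) (snd x) - (d2 (snd x) z2 - m x)\<bar> \<le> K"
      using rad1[of "fst x" "m x"] rad2[of "snd x" "m x"] that by (auto simp: mem_Y m_def)
    moreover have "d1 (fst x) z1 - m x \<le> \<Delta>" "d2 (snd x) z2 - m x \<le> \<Delta>"
      using that Delta_nonneg by (auto simp: mem_Y m_def abs_le_iff)
    ultimately show ?thesis
      using H1.commute[of "fst x"] H2.commute[of "snd x"] by (simp add: max_dist_eq r_def abs_le_iff)
  qed
  define c where "c = \<Delta> + K + C"
  have "\<exists>\<alpha> \<omega> \<gamma>. rough_geodesic (C + 2 * c + 2) Y dm \<alpha> \<omega> \<gamma> x y" if xy: "x \<in> Y" "y \<in> Y" for x y
  proof -
    define b where "b = p x y"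
    have p: "0 \<le> b" "b \<le> m x" "b \<le> m y"
    proof -
      have M: "fst x \<in> M1" "fst y \<in> M1" "snd x \<in> M2" "snd y \<in> M2" using xy by (auto simp: mem_Y)
      have "0 \<le> H1.gp (fst x) (fst y)" "0 \<le> H2.gp (snd x) (snd y)"
        using M by (simp_all add: H1.gromov_product_nonneg H2.gromov_product_nonneg H1.base_in H2.base_in)
      then show "0 \<le> b" by (simp add: b_def p_def)
      have "H1.gp (fst x) (fst y) \<le> d1 (fst x) z1" "H2.gp (snd x) (snd y) \<le> d2 (snd x) z2"
        using M by (simp_all add: H1.gromov_product_le H2.gromov_product_le H1.base_in H2.base_in)
      then show "b \<le> m x" unfolding b_def p_def m_def by (rule min.mono)
      have "H1.gp (fst x) (fst y) \<le> d1 (fst y) z1" "H2.gp (snd x) (snd y) \<le> d2 (snd y) z2"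
        using M H1.gromov_product_le[of "fst y" "fst x" z1] H2.gromov_product_le[of "snd y" "snd x" z2]
        by (simp_all add: H1.gromov_product_commute[of z1 "fst x"] H2.gromov_product_commute[of z2 "snd x"]
            H1.base_in H2.base_in)
      then show "b \<le> m y" unfolding b_def p_def m_def by (rule min.mono)
    qed
    define L where "L = m x + m y - 2 * b"
    define f where "f t = (if t \<le> m x - b then r x (m x - t) else r y (t - m x + 2 * b))" for t
    show ?thesis
    proof (rule Y.rough_geodesic_extend_ends)
      show "0 \<le> L" using p by (simp add: L_def)
      show "f t \<in> Y" if "t \<in> {0..L}" for t
        using that p rY xy unfolding f_def L_def by auto
      have 1: "\<bar>dm (f s) (f t) - \<bar>s - t\<bar>\<bar> \<le> C" if "s \<in> {0..L}" "t \<in> {0..L}" "s \<le> t" for s t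
      proof -
        consider "t \<le> m x - b" | "s > m x - b" | "s \<le> m x - b" "t > m x - b" by linarith
        then show ?thesis
        proof cases
          case 1
          then show ?thesis
            using same[OF xy(1), of "m x - s" "m x - t"] that p by (simp add: f_def)
        next
          case 2
          then show ?thesis
            using same[OF xy(2), of "s - m x + 2 * b" "t - m x + 2 * b"] that p by (simp add: f_def L_def)
        next
          case 3
          then show ?thesis
            using tripod[OF xy, of "m x - s" "t - m x + 2 * b"] that p
            by (simp add: f_def L_def flip: b_def)
        qed
      qed
      show "\<bar>dm (f s) (f t) - \<bar>s - t\<bar>\<bar> \<le> C" if "s \<in> {0..L}" "t \<in> {0..L}" for s t
        using 1[of s t] 1[of t s] that Y.commute[of "f s" "f t"] abs_minus_commute[of s t]
        by (cases "s \<le> t") auto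
      show "x \<in> Y" "y \<in> Y" by fact+
      show "dm x (f 0) \<le> c"
        using top[OF xy(1)] p K C by (simp add: f_def c_def)
      show "dm y (f L) \<le> c"
      proof (cases "m y = b")
        case True
        then have fL: "f L = r x b" by (simp add: f_def L_def)
        have "dm (r x b) (r y b) \<le> C"
          using tripod[OF xy, of b b] p by (simp flip: b_def)
        moreover have "dm y (f L) \<le> dm y (r y b) + dm (r y b) (f L)"
          using Y.triangle[of y "r y b" "f L"] xy rY p fL by auto
        ultimately show ?thesis
          using top[OF xy(2)] True fL Y.commute[of "r x b" "r y b"] by (simp add: c_def)
      next
        case False
        then have "f L = r y (m y)" using p by (simp add: f_def L_def)
        then show ?thesis using top[OF xy(2)] K C by (simp add: c_def)
      qed
    qed
  qed
  moreover have "C + 2 * c + 2 \<ge> 0" using K C Delta_nonneg by (simp add: c_def)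
  ultimately show ?thesis unfolding roughly_geodesic_def by blast
qed

lemma eventual_product_ge_Y_D:
  assumes "eventual_product_ge dm q x y r" "range x \<subseteq> Y" "range y \<subseteq> Y"
  shows "eventual_product_ge d1 z1 (fst \<circ> x) (fst \<circ> y) (r - \<Delta>)"
    and "eventual_product_ge d2 z2 (snd \<circ> x) (snd \<circ> y) (r - \<Delta>)"
proof -
  have "x i \<in> Y" "y i \<in> Y" for i using assms by auto
  note le = gp_Y_le[OF this]
  show "eventual_product_ge d1 z1 (fst \<circ> x) (fst \<circ> y) (r - \<Delta>)"
    by (rule eventual_product_ge_mono[OF assms(1), of _ "- \<Delta>"]) (use le(1) in \<open>auto simp: algebra_simps\<close>)
  show "eventual_product_ge d2 z2 (snd \<circ> x) (snd \<circ> y) (r - \<Delta>)"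
    by (rule eventual_product_ge_mono[OF assms(1), of _ "- \<Delta>"]) (use le(2) in \<open>auto simp: algebra_simps\<close>)
qed

lemma eventual_product_ge_Y_I:
  assumes "eventual_product_ge d1 z1 (fst \<circ> x) (fst \<circ> y) r"
    "eventual_product_ge d2 z2 (snd \<circ> x) (snd \<circ> y) r"
  shows "eventual_product_ge dm q x y r"
  using eventual_product_ge_conj[OF assms, of dm q x y] gp_Y_ge by simp

lemma all_eventual_product_ge_Y_iff:
  assumes "range x \<subseteq> Y" "range y \<subseteq> Y"
  shows "(\<forall>r. eventual_product_ge dm q x y r) \<longleftrightarrow>
     (\<forall>r. eventual_product_ge d1 z1 (fst \<circ> x) (fst \<circ> y) r) \<and>
     (\<forall>r. eventual_product_ge d2 z2 (snd \<circ> x) (snd \<circ> y) r)"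
proof (intro iffI conjI allI)
  fix r assume "\<forall>r. eventual_product_ge dm q x y r"
  then have "eventual_product_ge dm q x y (r + \<Delta>)" by blast
  from eventual_product_ge_Y_D[OF this assms]
  show "eventual_product_ge d1 z1 (fst \<circ> x) (fst \<circ> y) r"
    "eventual_product_ge d2 z2 (snd \<circ> x) (snd \<circ> y) r"
    by simp_all
qed (blast intro: eventual_product_ge_Y_I)

lemma range_components_Y:
  assumes "range x \<subseteq> Y"
  shows "range (fst \<circ> x) \<subseteq> M1" "range (snd \<circ> x) \<subseteq> M2"
proof -
  have "x i \<in> Y" for i using assms by auto
  then show "range (fst \<circ> x) \<subseteq> M1" "range (snd \<circ> x) \<subseteq> M2" by (auto simp: mem_Y)
qed

lemma mem_seqs_to_infinity_Y:
  "x \<in> seqs_to_infinity Y dm q \<longleftrightarrow> range x \<subseteq> Y \<and> 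
     fst \<circ> x \<in> seqs_to_infinity M1 d1 z1 \<and> snd \<circ> x \<in> seqs_to_infinity M2 d2 z2"
  using all_eventual_product_ge_Y_iff[of x x] range_components_Y[of x]
  unfolding mem_seqs_to_infinity by (cases "range x \<subseteq> Y") simp_all

lemma boundary_class_Y_eq_iff:
  assumes x: "x \<in> seqs_to_infinity Y dm q" and y: "y \<in> seqs_to_infinity Y dm q"
  shows "boundary_class Y dm q x = boundary_class Y dm q y \<longleftrightarrow>
     boundary_class M1 d1 z1 (fst \<circ> x) = boundary_class M1 d1 z1 (fst \<circ> y) \<and>
     boundary_class M2 d2 z2 (snd \<circ> x) = boundary_class M2 d2 z2 (snd \<circ> y)"
  using all_eventual_product_ge_Y_iff[of x y] x y
  by (simp add: Y.boundary_class_eq_iff H1.boundary_class_eq_iff H2.boundary_class_eq_iff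
      mem_boundary_rel mem_seqs_to_infinity_Y)

text \<open>Sequences in the two factors may escape at different speeds; moving both radially down to the
  lower of the two heights puts them into \<open>Y\<close> without changing their classes.\<close>

lemma boundary_classes_in_Y:
  assumes K: "0 \<le> K" "2 * K \<le> \<Delta>"
    and ex1: "\<And>x. x \<in> M1 \<Longrightarrow> \<exists>\<rho>. H1.radial_path K x \<rho>"
    and ex2: "\<And>x. x \<in> M2 \<Longrightarrow> \<exists>\<rho>. H2.radial_path K x \<rho>"
    and u: "u \<in> seqs_to_infinity M1 d1 z1" and w: "w \<in> seqs_to_infinity M2 d2 z2"
  obtains x where "x \<in> seqs_to_infinity Y dm q"
    "boundary_class M1 d1 z1 (fst \<circ> x) = boundary_class M1 d1 z1 u"
    "boundary_class M2 d2 z2 (snd \<circ> x) = boundary_class M2 d2 z2 w"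
proof -
  obtain \<rho>1 where \<rho>1: "\<And>x. x \<in> M1 \<Longrightarrow> H1.radial_path K x (\<rho>1 x)" using ex1 by metis
  obtain \<rho>2 where \<rho>2: "\<And>x. x \<in> M2 \<Longrightarrow> H2.radial_path K x (\<rho>2 x)" using ex2 by metis
  note rad1 = \<rho>1[unfolded H1.radial_path_def, rule_format]
    and rad2 = \<rho>2[unfolded H2.radial_path_def, rule_format]
  have uM: "u i \<in> M1" and wM: "w i \<in> M2" for i using u w by (auto simp: mem_seqs_to_infinity)
  define h where "h i = min (d1 (u i) z1) (d2 (w i) z2)" for i
  have h: "0 \<le> h i" "h i \<le> d1 (u i) z1" "h i \<le> d2 (w i) z2" for i by (auto simp: h_def)
  define x where "x i = (\<rho>1 (u i) (h i), \<rho>2 (w i) (h i))" for i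
  have x: "range x \<subseteq> Y"
  proof
    fix y assume "y \<in> range x"
    then obtain i where "y = x i" by auto
    then show "y \<in> Y"
      using rad1[OF uM, of "h i" i] rad2[OF wM, of "h i" i] h[of i] K by (auto simp: mem_Y x_def)
  qed
  have unbounded: "\<exists>N. \<forall>i\<ge>N. r \<le> h i - K" for r
  proof -
    obtain N where N: "\<And>i j. i \<ge> N \<Longrightarrow> j \<ge> N \<Longrightarrow> r + K \<le> H1.gp (u i) (u j)"
      using u unfolding mem_seqs_to_infinity eventual_product_ge_def by meson
    obtain N' where N': "\<And>i j. i \<ge> N' \<Longrightarrow> j \<ge> N' \<Longrightarrow> r + K \<le> H2.gp (w i) (w j)"
      using w unfolding mem_seqs_to_infinity eventual_product_ge_def by meson
    have "r \<le> h i - K" if "i \<ge> max N N'" for i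
      using N[of i i] N'[of i i] that uM[of i] wM[of i]
      by (simp add: h_def gromov_product_def)
    then show ?thesis by blast
  qed
  have "h i - K \<le> H1.gp (u i) (fst (x i))" "h i - K \<le> H2.gp (w i) (snd (x i))" for i
    using H1.radial_path_gp[OF \<rho>1, OF uM uM, of "h i" i] H2.radial_path_gp[OF \<rho>2, OF wM wM, of "h i" i] h[of i]
    by (simp_all add: x_def H1.gromov_product_commute[of _ "u i"] H2.gromov_product_commute[of _ "w i"])
  then have grow: "\<exists>N. \<forall>i\<ge>N. r \<le> H1.gp (u i) ((fst \<circ> x) i)" 
    "\<exists>N. \<forall>i\<ge>N. r \<le> H2.gp (w i) ((snd \<circ> x) i)" for r
    using unbounded[of r] unfolding comp_apply by (meson order_trans)+
  have rel: "(u, fst \<circ> x) \<in> boundary_rel M1 d1 z1" "(w, snd \<circ> x) \<in> boundary_rel M2 d2 z2"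
    using H1.boundary_rel_if_product_unbounded[OF u range_components_Y(1)[OF x] grow(1)]
      H2.boundary_rel_if_product_unbounded[OF w range_components_Y(2)[OF x] grow(2)] by blast+
  show ?thesis
  proof
    show 1: "x \<in> seqs_to_infinity Y dm q"
      using x rel by (simp add: mem_seqs_to_infinity_Y mem_boundary_rel)
    show "boundary_class M1 d1 z1 (fst \<circ> x) = boundary_class M1 d1 z1 u"
      using H1.boundary_class_eq_iff[of u "fst \<circ> x"] rel(1) u 1 unfolding mem_seqs_to_infinity_Y by blast
    show "boundary_class M2 d2 z2 (snd \<circ> x) = boundary_class M2 d2 z2 w"
      using H2.boundary_class_eq_iff[of w "snd \<circ> x"] rel(2) w 1 unfolding mem_seqs_to_infinity_Y by blast
  qed
qed

lemma boundary_nbhd_Y_D: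
  assumes x: "x \<in> seqs_to_infinity Y dm q" and y: "y \<in> seqs_to_infinity Y dm q"
    and "boundary_class Y dm q y \<in> boundary_nbhd Y dm q (boundary_class Y dm q x) s"
    and s: "r + 5 * \<Delta> + 4 * \<delta>1 + 4 * \<delta>2 < s"
  shows "boundary_class M1 d1 z1 (fst \<circ> y) \<in> boundary_nbhd M1 d1 z1 (boundary_class M1 d1 z1 (fst \<circ> x)) r"
    and "boundary_class M2 d2 z2 (snd \<circ> y) \<in> boundary_nbhd M2 d2 z2 (boundary_class M2 d2 z2 (snd \<circ> x)) r"
proof -
  have "eventual_product_ge dm q x y (s - 2 * (2 * (\<Delta> + \<delta>1 + \<delta>2)))"
    by (rule Y.eventual_product_ge_if_mem_boundary_nbhd[OF assms(1-3)])
  note ge = eventual_product_ge_Y_D[OF this]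
  have r: "r < s - 2 * (2 * (\<Delta> + \<delta>1 + \<delta>2)) - \<Delta>" using s by simp
  show "boundary_class M1 d1 z1 (fst \<circ> y) \<in> boundary_nbhd M1 d1 z1 (boundary_class M1 d1 z1 (fst \<circ> x)) r"
    by (rule H1.mem_boundary_nbhd_if_eventual_product_ge[OF _ _ ge(1) r])
      (use x y in \<open>auto simp: mem_seqs_to_infinity_Y\<close>)
  show "boundary_class M2 d2 z2 (snd \<circ> y) \<in> boundary_nbhd M2 d2 z2 (boundary_class M2 d2 z2 (snd \<circ> x)) r"
    by (rule H2.mem_boundary_nbhd_if_eventual_product_ge[OF _ _ ge(2) r])
      (use x y in \<open>auto simp: mem_seqs_to_infinity_Y\<close>)
qed

lemma boundary_nbhd_Y_I:
  assumes x: "x \<in> seqs_to_infinity Y dm q" and y: "y \<in> seqs_to_infinity Y dm q"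
    and 1: "boundary_class M1 d1 z1 (fst \<circ> y) \<in> boundary_nbhd M1 d1 z1 (boundary_class M1 d1 z1 (fst \<circ> x)) s"
    and 2: "boundary_class M2 d2 z2 (snd \<circ> y) \<in> boundary_nbhd M2 d2 z2 (boundary_class M2 d2 z2 (snd \<circ> x)) s"
    and s: "r + 2 * \<delta>1 + 2 * \<delta>2 < s"
  shows "boundary_class Y dm q y \<in> boundary_nbhd Y dm q (boundary_class Y dm q x) r"
proof -
  define t where "t = s - 2 * \<delta>1 - 2 * \<delta>2"
  have "eventual_product_ge d1 z1 (fst \<circ> x) (fst \<circ> y) (s - 2 * \<delta>1)"
    using H1.eventual_product_ge_if_mem_boundary_nbhd[OF _ _ 1] x y by (simp add: mem_seqs_to_infinity_Y)
  then have 3: "eventual_product_ge d1 z1 (fst \<circ> x) (fst \<circ> y) t"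
    by (rule eventual_product_ge_mono[of _ _ _ _ _ _ 0]) (use H2.delta_nonneg in \<open>auto simp: t_def\<close>)
  have "eventual_product_ge d2 z2 (snd \<circ> x) (snd \<circ> y) (s - 2 * \<delta>2)"
    using H2.eventual_product_ge_if_mem_boundary_nbhd[OF _ _ 2] x y by (simp add: mem_seqs_to_infinity_Y)
  then have 4: "eventual_product_ge d2 z2 (snd \<circ> x) (snd \<circ> y) t"
    by (rule eventual_product_ge_mono[of _ _ _ _ _ _ 0]) (use H1.delta_nonneg in \<open>auto simp: t_def\<close>)
  have "r < t" using s by (simp add: t_def)
  then show ?thesis
    using Y.mem_boundary_nbhd_if_eventual_product_ge[OF x y eventual_product_ge_Y_I[OF 3 4]] by blast
qed

lemma boundary_homeomorphism:
  assumes K: "0 \<le> K" "2 * K \<le> \<Delta>"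
    and ex1: "\<And>x. x \<in> M1 \<Longrightarrow> \<exists>\<rho>. H1.radial_path K x \<rho>"
    and ex2: "\<And>x. x \<in> M2 \<Longrightarrow> \<exists>\<rho>. H2.radial_path K x \<rho>"
  obtains \<Phi> where
    "homeomorphic_map (boundary_topology Y dm q)
       (prod_topology (boundary_topology M1 d1 z1) (boundary_topology M2 d2 z2)) \<Phi>"
    "\<And>x. x \<in> seqs_to_infinity Y dm q \<Longrightarrow> \<Phi> (boundary_class Y dm q x) =
       (boundary_class M1 d1 z1 (fst \<circ> x), boundary_class M2 d2 z2 (snd \<circ> x))"
proof -
  let ?S = "seqs_to_infinity Y dm q" and ?c = "boundary_class Y dm q"
  let ?c1 = "boundary_class M1 d1 z1" and ?c2 = "boundary_class M2 d2 z2"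
  let ?T = "boundary_topology Y dm q"
  let ?P = "prod_topology (boundary_topology M1 d1 z1) (boundary_topology M2 d2 z2)"
  define \<Phi> where "\<Phi> v = (let x = (SOME x. x \<in> ?S \<and> ?c x = v) in (?c1 (fst \<circ> x), ?c2 (snd \<circ> x)))" for v
  have \<Phi>: "\<Phi> (?c x) = (?c1 (fst \<circ> x), ?c2 (snd \<circ> x))" if "x \<in> ?S" for x
  proof -
    define y where "y = (SOME y. y \<in> ?S \<and> ?c y = ?c x)"
    have "y \<in> ?S \<and> ?c y = ?c x" unfolding y_def by (rule someI[of _ x]) (use that in simp)
    then have "?c1 (fst \<circ> y) = ?c1 (fst \<circ> x) \<and> ?c2 (snd \<circ> y) = ?c2 (snd \<circ> x)"
      using boundary_class_Y_eq_iff that by blast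
    then show ?thesis by (simp add: \<Phi>_def Let_def flip: y_def)
  qed
  have inj: "inj_on \<Phi> (topspace ?T)"
  proof (rule inj_onI)
    fix v w assume "v \<in> topspace ?T" "w \<in> topspace ?T" and eq: "\<Phi> v = \<Phi> w"
    then obtain x y where "x \<in> ?S" "v = ?c x" "y \<in> ?S" "w = ?c y"
      by (auto simp: Y.boundary_at_infinity_eq)
    then show "v = w" using eq \<Phi> boundary_class_Y_eq_iff[of x y] by simp
  qed
  have in_boundary: "\<Phi> (?c x) \<in> topspace ?P" if "x \<in> ?S" for x
    using \<Phi>[OF that] that H1.boundary_class_in_boundary H2.boundary_class_in_boundary
    by (simp add: mem_seqs_to_infinity_Y)
  have surj: "\<exists>x\<in>?S. v = \<Phi> (?c x)" if v: "v \<in> topspace ?P" for v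
  proof -
    obtain u w where "u \<in> seqs_to_infinity M1 d1 z1" "w \<in> seqs_to_infinity M2 d2 z2" "v = (?c1 u, ?c2 w)"
      using v unfolding topspace_prod_topology topspace_boundary_topology
        H1.boundary_at_infinity_eq H2.boundary_at_infinity_eq by blast
    then show ?thesis
      using boundary_classes_in_Y[OF K ex1 ex2, of u w] \<Phi> by metis
  qed
  have image: "\<Phi> ` topspace ?T = topspace ?P"
    unfolding topspace_boundary_topology[of Y] Y.boundary_at_infinity_eq image_image
    using in_boundary surj by blast
  have "openin ?T {v \<in> topspace ?T. \<Phi> v \<in> W} \<longleftrightarrow> openin ?P W" if W: "W \<subseteq> topspace ?P" for W
  proof
    assume open_Y: "openin ?T {v \<in> topspace ?T. \<Phi> v \<in> W}"
    show "openin ?P W"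
      unfolding openin_prod_topology_alt
    proof (intro allI impI)
      fix a b assume "(a, b) \<in> W"
      then obtain x where x: "x \<in> ?S" "(a, b) = \<Phi> (?c x)" using surj W by blast
      then have ab: "a = ?c1 (fst \<circ> x)" "b = ?c2 (snd \<circ> x)" using \<Phi> by auto
      have "?c x \<in> {v \<in> topspace ?T. \<Phi> v \<in> W}"
        using x \<open>(a, b) \<in> W\<close> Y.boundary_class_in_boundary by auto
      then obtain r where r: "boundary_nbhd Y dm q (?c x) r \<subseteq> {v \<in> topspace ?T. \<Phi> v \<in> W}"
        using open_Y unfolding openin_boundary_topology by blast
      define s where "s = r + 2 * \<delta>1 + 2 * \<delta>2 + 1"
      have "a \<in> boundary_at_infinity M1 d1 z1" "b \<in> boundary_at_infinity M2 d2 z2"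
        using W \<open>(a, b) \<in> W\<close> by auto
      obtain U where U: "openin (boundary_topology M1 d1 z1) U" "a \<in> U" "U \<subseteq> boundary_nbhd M1 d1 z1 a s"
        using H1.boundary_nbhd_contains_open[OF \<open>a \<in> _\<close>] by blast
      obtain V where V: "openin (boundary_topology M2 d2 z2) V" "b \<in> V" "V \<subseteq> boundary_nbhd M2 d2 z2 b s"
        using H2.boundary_nbhd_contains_open[OF \<open>b \<in> _\<close>] by blast
      have "U \<times> V \<subseteq> W"
      proof
        fix v assume v: "v \<in> U \<times> V"
        have "v \<in> topspace ?P" using v openin_subset[OF U(1)] openin_subset[OF V(1)] by auto
        then obtain y where y: "y \<in> ?S" "v = \<Phi> (?c y)" using surj by blast
        have "?c y \<in> boundary_nbhd Y dm q (?c x) r"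
        proof (rule boundary_nbhd_Y_I[OF x(1) y(1)])
          show "?c1 (fst \<circ> y) \<in> boundary_nbhd M1 d1 z1 (?c1 (fst \<circ> x)) s"
            "?c2 (snd \<circ> y) \<in> boundary_nbhd M2 d2 z2 (?c2 (snd \<circ> x)) s"
            using v y \<Phi>[OF y(1)] U(3) V(3) ab by auto
        qed (simp add: s_def)
        then show "v \<in> W" using r y by blast
      qed
      then show "\<exists>U V. openin (boundary_topology M1 d1 z1) U \<and> openin (boundary_topology M2 d2 z2) V \<and>
          a \<in> U \<and> b \<in> V \<and> U \<times> V \<subseteq> W"
        using U V by blast
    qed
  next
    assume open_W: "openin ?P W"
    show "openin ?T {v \<in> topspace ?T. \<Phi> v \<in> W}"
      unfolding openin_boundary_topology
    proof (intro conjI ballI)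
      show "{v \<in> topspace ?T. \<Phi> v \<in> W} \<subseteq> boundary_at_infinity Y dm q" by auto
      fix v assume "v \<in> {v \<in> topspace ?T. \<Phi> v \<in> W}"
      then obtain x where x: "x \<in> ?S" "v = ?c x" "\<Phi> (?c x) \<in> W"
        by (auto simp: Y.boundary_at_infinity_eq)
      then obtain U V where UV: "openin (boundary_topology M1 d1 z1) U"
          "openin (boundary_topology M2 d2 z2) V"
          "?c1 (fst \<circ> x) \<in> U" "?c2 (snd \<circ> x) \<in> V" "U \<times> V \<subseteq> W"
        using open_W \<Phi> unfolding openin_prod_topology_alt by metis
      obtain r1 where r1: "r1 > 0" "boundary_nbhd M1 d1 z1 (?c1 (fst \<circ> x)) r1 \<subseteq> U"
        using UV(1,3) unfolding openin_boundary_topology by blast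
      obtain r2 where r2: "r2 > 0" "boundary_nbhd M2 d2 z2 (?c2 (snd \<circ> x)) r2 \<subseteq> V"
        using UV(2,4) unfolding openin_boundary_topology by blast
      define s where "s = r1 + r2 + 5 * \<Delta> + 4 * \<delta>1 + 4 * \<delta>2 + 1"
      have s: "s > 0" "r1 + 5 * \<Delta> + 4 * \<delta>1 + 4 * \<delta>2 < s" "r2 + 5 * \<Delta> + 4 * \<delta>1 + 4 * \<delta>2 < s"
        using r1(1) r2(1) Delta_nonneg H1.delta_nonneg H2.delta_nonneg by (auto simp: s_def)
      have "boundary_nbhd Y dm q v s \<subseteq> {v \<in> topspace ?T. \<Phi> v \<in> W}"
      proof
        fix w assume w: "w \<in> boundary_nbhd Y dm q v s"
        then obtain y where y: "y \<in> ?S" "w = ?c y" unfolding mem_boundary_nbhd by blast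
        have "?c1 (fst \<circ> y) \<in> U" "?c2 (snd \<circ> y) \<in> V"
          using boundary_nbhd_Y_D(1)[OF x(1) y(1) _ s(2)] boundary_nbhd_Y_D(2)[OF x(1) y(1) _ s(3)]
            w x y r1 r2 by auto
        then have "\<Phi> w \<in> W" using UV(5) y \<Phi> by auto
        then show "w \<in> {v \<in> topspace ?T. \<Phi> v \<in> W}"
          using y Y.boundary_class_in_boundary by simp
      qed
      then show "\<exists>r>0. boundary_nbhd Y dm q v r \<subseteq> {v \<in> topspace ?T. \<Phi> v \<in> W}" using s(1) by blast
    qed
  qed
  then have "homeomorphic_map ?T ?P \<Phi>"
    using image inj by (auto simp: homeomorphic_map_def quotient_map_def)
  then show ?thesis using that \<Phi> by blast
qed

end

theorem theorem2:
  fixes X1 :: "'a set" and d1 :: "'a \<Rightarrow> 'a \<Rightarrow> real" and z1 :: 'a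
    and X2 :: "'b set" and d2 :: "'b \<Rightarrow> 'b \<Rightarrow> real" and z2 :: 'b
  assumes "Metric_space X1 d1" and "roughly_geodesic X1 d1" and "gromov_hyperbolic X1 d1"
    and "Metric_space X2 d2" and "roughly_geodesic X2 d2" and "gromov_hyperbolic X2 d2"
    and "z1 \<in> X1" and "z2 \<in> X2"
  shows "\<exists>\<Delta>'\<ge>0. \<forall>\<Delta>\<ge>\<Delta>'.
    (let Y = diagonal_product X1 d1 z1 X2 d2 z2 \<Delta>; dm = max_dist d1 d2 in
       Metric_space Y dm \<and> roughly_geodesic Y dm \<and> gromov_hyperbolic Y dm \<and>
       (\<forall>p1\<in>X1. \<forall>p2\<in>X2. \<forall>q\<in>Y.
          \<exists>\<Phi>. homeomorphic_map (boundary_topology Y dm q)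
                 (prod_topology (boundary_topology X1 d1 p1) (boundary_topology X2 d2 p2)) \<Phi> \<and>
              (\<forall>x\<in>seqs_to_infinity Y dm q.
                 fst \<circ> x \<in> seqs_to_infinity X1 d1 p1 \<and>
                 snd \<circ> x \<in> seqs_to_infinity X2 d2 p2 \<and>
                 \<Phi> (boundary_class Y dm q x) =
                   (boundary_class X1 d1 p1 (fst \<circ> x), boundary_class X2 d2 p2 (snd \<circ> x)))))"
proof -
  obtain \<delta>1 where \<delta>1: "0 \<le> \<delta>1" "delta_hyperbolic \<delta>1 X1 d1"
    using assms(3) unfolding gromov_hyperbolic_def by blast
  obtain \<delta>2 where \<delta>2: "0 \<le> \<delta>2" "delta_hyperbolic \<delta>2 X2 d2"
    using assms(6) unfolding gromov_hyperbolic_def by blast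
  interpret H1: pointed_hyperbolic X1 d1 \<delta>1 z1
    using assms \<delta>1 by (simp add: pointed_hyperbolic_def pointed_hyperbolic_axioms_def)
  interpret H2: pointed_hyperbolic X2 d2 \<delta>2 z2
    using assms \<delta>2 by (simp add: pointed_hyperbolic_def pointed_hyperbolic_axioms_def)
  obtain K1 where K1: "0 \<le> K1" "\<And>x. x \<in> X1 \<Longrightarrow> \<exists>\<rho>. H1.radial_path K1 x \<rho>"
    using H1.radial_path_exists[OF assms(2)] by blast
  obtain K2 where K2: "0 \<le> K2" "\<And>x. x \<in> X2 \<Longrightarrow> \<exists>\<rho>. H2.radial_path K2 x \<rho>"
    using H2.radial_path_exists[OF assms(5)] by blast
  define K where "K = max K1 K2"
  have K: "0 \<le> K" "K1 \<le> K" "K2 \<le> K" using K1(1) by (auto simp: K_def)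
  have ex1: "\<exists>\<rho>. H1.radial_path K x \<rho>" if "x \<in> X1" for x
    using K1(2)[OF that] H1.radial_path_mono K(2) by blast
  have ex2: "\<exists>\<rho>. H2.radial_path K x \<rho>" if "x \<in> X2" for x
    using K2(2)[OF that] H2.radial_path_mono K(3) by blast
  show ?thesis
    unfolding Let_def
  proof (intro exI[of _ "2 * K"] conjI allI impI ballI)
    show "0 \<le> 2 * K" using K by simp
    fix \<Delta> assume \<Delta>: "2 * K \<le> \<Delta>"
    interpret hyperbolic_pair X1 d1 \<delta>1 z1 X2 d2 \<delta>2 z2 \<Delta>
      by unfold_locales (use K \<Delta> in simp)
    show "Metric_space Y dm" by (rule Y.Metric_space_axioms)
    show "roughly_geodesic Y dm"
      by (rule roughly_geodesic_Y[OF K(1) \<Delta> ex1 ex2])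
    show "gromov_hyperbolic Y dm"
      using Y.hyperbolic Y.delta_nonneg unfolding gromov_hyperbolic_def by blast
    fix p1 p2 y assume p: "p1 \<in> X1" "p2 \<in> X2" "y \<in> Y"
    obtain \<Phi> where \<Phi>: "homeomorphic_map (boundary_topology Y dm q)
         (prod_topology (boundary_topology X1 d1 z1) (boundary_topology X2 d2 z2)) \<Phi>"
      "\<And>x. x \<in> seqs_to_infinity Y dm q \<Longrightarrow> \<Phi> (boundary_class Y dm q x) =
         (boundary_class X1 d1 z1 (fst \<circ> x), boundary_class X2 d2 z2 (snd \<circ> x))"
      using boundary_homeomorphism[OF K(1) \<Delta> ex1 ex2] by blast
    note base = H1.boundary_topology_change_base[OF p(1) assms(7)]
      H2.boundary_topology_change_base[OF p(2) assms(8)]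
      Y.boundary_topology_change_base[OF p(3) q_in_Y]
      H1.boundary_class_change_base[OF p(1) assms(7)]
      H2.boundary_class_change_base[OF p(2) assms(8)]
      Y.boundary_class_change_base[OF p(3) q_in_Y]
      H1.seqs_to_infinity_change_base[OF p(1) assms(7)]
      H2.seqs_to_infinity_change_base[OF p(2) assms(8)]
      Y.seqs_to_infinity_change_base[OF p(3) q_in_Y]
    show "\<exists>\<Phi>. homeomorphic_map (boundary_topology Y dm y)
           (prod_topology (boundary_topology X1 d1 p1) (boundary_topology X2 d2 p2)) \<Phi> \<and>
        (\<forall>x\<in>seqs_to_infinity Y dm y.
           fst \<circ> x \<in> seqs_to_infinity X1 d1 p1 \<and> snd \<circ> x \<in> seqs_to_infinity X2 d2 p2 \<and>
           \<Phi> (boundary_class Y dm y x) =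
             (boundary_class X1 d1 p1 (fst \<circ> x), boundary_class X2 d2 p2 (snd \<circ> x)))"
      unfolding base using \<Phi> mem_seqs_to_infinity_Y by blast
  qed
qed

end
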